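(* Let $n\ge 1$ be an integer and let $G$ be a solvable group such that either (a) $G$ is a $\mathcal{T}(3,n)$-group, or (b) $G$ is a finite $\mathcal{T}(4,n)$-group of odd order. Then the derived length $d$ of $G$ satisfies $d\le \log_2(2n)$.
   Context: For integers $m\ge 2$ and $n\ge 1$, a group $G$ is called a $\mathcal{T}(m,n)$-group if for every $m$ subsets $X_1,\dots,X_m$ of $G$, each of cardinality $n$, there exist indices $i\ne j$ and elements $x_i\in X_i$, $x_j\in X_j$ such that $x_ix_j=x_jx_i$. *)

theory Defs
  imports Complex_Main "HOL-Algebra.Algebra"
begin

(* Meant for m >= 2 and n >= 1. A family A i, i in {1..m}, may contain repetitions;
   this is immaterial, since an element of a repeated nonempty set commutes with itself. *)
definition T_group :: "nat \<Rightarrow> nat \<Rightarrow> ('a, 'b) monoid_scheme \<Rightarrow> bool" where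
  "T_group m n G \<longleftrightarrow> group G \<and>
     (\<forall>A :: nat \<Rightarrow> 'a set.
        (\<forall>i\<in>{1..m}. A i \<subseteq> carrier G \<and> finite (A i) \<and> card (A i) = n) \<longrightarrow>
        (\<exists>i\<in>{1..m}. \<exists>j\<in>{1..m}. i \<noteq> j \<and>
           (\<exists>x\<in>A i. \<exists>y\<in>A j. x \<otimes>\<^bsub>G\<^esub> y = y \<otimes>\<^bsub>G\<^esub> x)))"

(* Only meaningful for solvable G, where the derived series reaches the trivial subgroup. *)
definition derived_length :: "('a, 'b) monoid_scheme \<Rightarrow> nat" where
  "derived_length G = (LEAST k. (derived G ^^ k) (carrier G) = {\<one>\<^bsub>G\<^esub>})"

lemma (in group) derived_length_trivial:
  assumes "solvable G"
  shows "(derived G ^^ derived_length G) (carrier G) = {\<one>}"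
  using assms unfolding derived_length_def solvable_iff_trivial_derived_seq
  by (rule LeastI_ex)

end

theory Submission
  imports Defs
begin

text \<open>
  If \<open>N\<close> is a normal subgroup of a \<open>T(m,n)\<close>-group \<open>G\<close>, then lifting subsets along cosets shows that
  \<open>G/N\<close> is a \<open>T(m,r)\<close>-group as soon as \<open>n \<le> r|N|\<close>.  Let \<open>d\<close> be the derived length.

  In case (b), every proper inclusion of subgroups has index at least 3, so for \<open>d \<ge> 2\<close> one has
  \<open>|G''| \<ge> 3^(d-2) \<ge> 2^(d-1) - 1\<close>.  If \<open>n < 2^(d-1)\<close>, then \<open>G/G''\<close> is a \<open>T(4,1)\<close>-group of odd order; for
  noncommuting \<open>x, y\<close> the four elements \<open>x, y, xy, xy^-1\<close> contradict this.

  In case (a) the index is only at least 2, and the same argument with \<open>G''\<close> loses one unit.  Instead,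
  \<open>|G'''| \<ge> 2^(d-3)\<close> for \<open>d \<ge> 3\<close>, and it suffices that a \<open>T(3,4)\<close>-group \<open>H\<close> has \<open>H'' = 1\<close> or
  \<open>H'' = H'\<close>.  If \<open>|H''| \<ge> 4\<close>, then \<open>H/H''\<close> is a \<open>T(3,1)\<close>-group, hence abelian.  If \<open>|H''|\<close> is 2 or 3,
  then \<open>H/H''\<close> is a \<open>T(3,2)\<close>-group and \<open>H'\<close> centralises \<open>H''\<close>; for noncommuting \<open>x, y\<close> in \<open>H'\<close> the
  elements \<open>1, x, y, xy\<close> are then distinct modulo \<open>H''\<close>, and a \<open>T(3,2)\<close>-group with an abelian normal
  subgroup of order at least 4 is abelian.
\<close>

section \<open>Enlarging \<open>n\<close> and passing to quotients\<close>

lemma T_group_mono: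
  assumes "T_group m n G" "n \<le> n'"
  shows "T_group m n' G"
  unfolding T_group_def
proof (intro conjI allI impI)
  show "group G" using assms(1) by (simp add: T_group_def)
  fix A :: "nat \<Rightarrow> 'a set"
  assume A: "\<forall>i\<in>{1..m}. A i \<subseteq> carrier G \<and> finite (A i) \<and> card (A i) = n'"
  have "\<forall>i\<in>{1..m}. \<exists>B. B \<subseteq> A i \<and> card B = n \<and> finite B"
    using A assms(2) by (metis obtain_subset_with_card_n)
  then obtain B where B: "\<And>i. i \<in> {1..m} \<Longrightarrow> B i \<subseteq> A i \<and> card (B i) = n \<and> finite (B i)"
    by metis
  then have "\<forall>i\<in>{1..m}. B i \<subseteq> carrier G \<and> finite (B i) \<and> card (B i) = n"
    using A by blast
  with assms(1) have "\<exists>i\<in>{1..m}. \<exists>j\<in>{1..m}. i \<noteq> j \<and>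
      (\<exists>x\<in>B i. \<exists>y\<in>B j. x \<otimes>\<^bsub>G\<^esub> y = y \<otimes>\<^bsub>G\<^esub> x)"
    unfolding T_group_def by blast
  then show "\<exists>i\<in>{1..m}. \<exists>j\<in>{1..m}. i \<noteq> j \<and>
      (\<exists>x\<in>A i. \<exists>y\<in>A j. x \<otimes>\<^bsub>G\<^esub> y = y \<otimes>\<^bsub>G\<^esub> x)"
    using B by blast
qed

text \<open>A set of \<open>r\<close> cosets lifts to \<open>card F * r\<close> elements
  \<open>f \<otimes> rep c\<close>, and commuting lifts project to commuting cosets. Using a finite
  subset \<open>F\<close> in place of \<open>N\<close> itself also covers infinite
  \<open>N\<close>.\<close>

lemma T_group_Mod:
  assumes T: "T_group m n G" and N: "N \<lhd> G"
    and F: "F \<subseteq> N" "finite F" and le: "n \<le> card F * r"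
  shows "T_group m r (G Mod N)"
  unfolding T_group_def
proof (intro conjI allI impI)
  interpret N: normal N G by fact
  show "group (G Mod N)" by (rule N.factorgroup_is_group)
  have T': "T_group m (card F * r) G" using T_group_mono[OF T le] .
  fix B :: "nat \<Rightarrow> 'a set set"
  assume B: "\<forall>i\<in>{1..m}. B i \<subseteq> carrier (G Mod N) \<and> finite (B i) \<and> card (B i) = r"
  have "\<forall>c\<in>carrier (G Mod N). \<exists>g\<in>carrier G. c = N #>\<^bsub>G\<^esub> g"
    by (auto simp: FactGroup_def RCOSETS_def)
  then obtain rep where rep: "\<And>c. c \<in> carrier (G Mod N) \<Longrightarrow> rep c \<in> carrier G \<and> c = N #>\<^bsub>G\<^esub> rep c"
    by metis
  have coset: "N #>\<^bsub>G\<^esub> (f \<otimes>\<^bsub>G\<^esub> rep c) = c" if "f \<in> F" "c \<in> carrier (G Mod N)" for f c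
    using that rep[OF that(2)] F
    by (metis N.coset_mult_assoc N.rcos_const N.subset N.is_group subset_iff)
  define A where "A i = (\<lambda>(f, c). f \<otimes>\<^bsub>G\<^esub> rep c) ` (F \<times> B i)" for i
  \<comment> \<open>The product lies in the coset \<open>c\<close>, so it determines
    \<open>c\<close>; cancelling \<open>rep c\<close> then recovers \<open>f\<close>.\<close>
  have inj: "inj_on (\<lambda>(f, c). f \<otimes>\<^bsub>G\<^esub> rep c) (F \<times> carrier (G Mod N))"
  proof (rule inj_onI, clarify)
    fix f c f' c'
    assume *: "f \<in> F" "f' \<in> F" "c \<in> carrier (G Mod N)" "c' \<in> carrier (G Mod N)"
      "f \<otimes>\<^bsub>G\<^esub> rep c = f' \<otimes>\<^bsub>G\<^esub> rep c'"
    then have "c = c'" using coset by metis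
    with * show "f = f' \<and> c = c'"
      using rep F by (metis N.r_cancel N.subset subset_iff)
  qed
  have "\<forall>i\<in>{1..m}. A i \<subseteq> carrier G \<and> finite (A i) \<and> card (A i) = card F * r"
  proof
    fix i assume i: "i \<in> {1..m}"
    have "inj_on (\<lambda>(f, c). f \<otimes>\<^bsub>G\<^esub> rep c) (F \<times> B i)"
      by (rule inj_on_subset[OF inj]) (use B i in auto)
    then have "card (A i) = card F * r"
      unfolding A_def using B i by (simp add: card_image card_cartesian_product)
    moreover have "A i \<subseteq> carrier G"
    proof
      fix z assume "z \<in> A i"
      then obtain f c where fc: "f \<in> F" "c \<in> B i" "z = f \<otimes>\<^bsub>G\<^esub> rep c"
        unfolding A_def by auto
      moreover have "c \<in> carrier (G Mod N)" using B i fc(2) by blast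
      ultimately show "z \<in> carrier G" using rep F N.subset by (metis N.m_closed subset_iff)
    qed
    ultimately show "A i \<subseteq> carrier G \<and> finite (A i) \<and> card (A i) = card F * r"
      unfolding A_def using B i F by simp
  qed
  with T' obtain i j x y where ij: "i \<in> {1..m}" "j \<in> {1..m}" "i \<noteq> j"
    and xy: "x \<in> A i" "y \<in> A j" "x \<otimes>\<^bsub>G\<^esub> y = y \<otimes>\<^bsub>G\<^esub> x"
    unfolding T_group_def by blast
  have *: "N #>\<^bsub>G\<^esub> z \<in> B k \<and> z \<in> carrier G" if z: "z \<in> A k" and k: "k \<in> {1..m}" for z k
  proof -
    obtain f c where fc: "f \<in> F" "c \<in> B k" "z = f \<otimes>\<^bsub>G\<^esub> rep c"
      using z unfolding A_def by auto
    moreover have "c \<in> carrier (G Mod N)" using B k fc by blast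
    ultimately show ?thesis using coset rep F N.subset by (metis N.m_closed subset_iff)
  qed
  have "(N #>\<^bsub>G\<^esub> x) \<otimes>\<^bsub>G Mod N\<^esub> (N #>\<^bsub>G\<^esub> y) = (N #>\<^bsub>G\<^esub> y) \<otimes>\<^bsub>G Mod N\<^esub> (N #>\<^bsub>G\<^esub> x)"
    using * xy ij by (simp add: FactGroup_def N.rcos_sum)
  then show "\<exists>i\<in>{1..m}. \<exists>j\<in>{1..m}. i \<noteq> j \<and>
      (\<exists>x\<in>B i. \<exists>y\<in>B j. x \<otimes>\<^bsub>G Mod N\<^esub> y = y \<otimes>\<^bsub>G Mod N\<^esub> x)"
    using * xy ij by blast
qed

lemma T_group_3D:
  assumes "T_group 3 n G"
    and "P \<subseteq> carrier G" "finite P" "card P = n"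
    and "Q \<subseteq> carrier G" "finite Q" "card Q = n"
    and "R \<subseteq> carrier G" "finite R" "card R = n"
  shows "(\<exists>x\<in>P. \<exists>y\<in>Q. x \<otimes>\<^bsub>G\<^esub> y = y \<otimes>\<^bsub>G\<^esub> x) \<or>
    (\<exists>x\<in>P. \<exists>y\<in>R. x \<otimes>\<^bsub>G\<^esub> y = y \<otimes>\<^bsub>G\<^esub> x) \<or>
    (\<exists>x\<in>Q. \<exists>y\<in>R. x \<otimes>\<^bsub>G\<^esub> y = y \<otimes>\<^bsub>G\<^esub> x)"
proof -
  define A where "A i = (if i = 1 then P else if i = 2 then Q else R)" for i :: nat
  have "\<forall>i\<in>{1..3}. A i \<subseteq> carrier G \<and> finite (A i) \<and> card (A i) = n"
    using assms by (auto simp: A_def)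
  with assms(1) obtain i j x y where "i \<in> {1..3::nat}" "j \<in> {1..3::nat}" "i \<noteq> j"
    "x \<in> A i" "y \<in> A j" "x \<otimes>\<^bsub>G\<^esub> y = y \<otimes>\<^bsub>G\<^esub> x"
    unfolding T_group_def by blast
  moreover from this have "i = 1 \<or> i = 2 \<or> i = 3" "j = 1 \<or> j = 2 \<or> j = 3" by auto
  ultimately show ?thesis unfolding A_def by (elim disjE) (simp_all, metis+)
qed

lemma T_group_4_1D:
  assumes "T_group 4 1 G"
    and "x \<in> carrier G" "y \<in> carrier G" "z \<in> carrier G" "w \<in> carrier G"
  shows "x \<otimes>\<^bsub>G\<^esub> y = y \<otimes>\<^bsub>G\<^esub> x \<or>
    x \<otimes>\<^bsub>G\<^esub> z = z \<otimes>\<^bsub>G\<^esub> x \<or>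
    x \<otimes>\<^bsub>G\<^esub> w = w \<otimes>\<^bsub>G\<^esub> x \<or>
    y \<otimes>\<^bsub>G\<^esub> z = z \<otimes>\<^bsub>G\<^esub> y \<or>
    y \<otimes>\<^bsub>G\<^esub> w = w \<otimes>\<^bsub>G\<^esub> y \<or>
    z \<otimes>\<^bsub>G\<^esub> w = w \<otimes>\<^bsub>G\<^esub> z"
proof -
  define A where "A i = (if i = 1 then {x} else if i = 2 then {y} else if i = 3 then {z} else {w})" for i :: nat
  have "\<forall>i\<in>{1..4}. A i \<subseteq> carrier G \<and> finite (A i) \<and> card (A i) = 1"
    using assms by (auto simp: A_def)
  with assms(1) obtain i j p q where "i \<in> {1..4::nat}" "j \<in> {1..4::nat}" "i \<noteq> j"
    "p \<in> A i" "q \<in> A j" "p \<otimes>\<^bsub>G\<^esub> q = q \<otimes>\<^bsub>G\<^esub> p"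
    unfolding T_group_def by blast
  moreover from this have "i = 1 \<or> i = 2 \<or> i = 3 \<or> i = 4" "j = 1 \<or> j = 2 \<or> j = 3 \<or> j = 4"
    by auto
  ultimately show ?thesis unfolding A_def by (elim disjE) simp_all
qed

section \<open>Commutativity from small parameters\<close>

context group
begin

lemma inv_mult_cancel:
  assumes "x \<in> carrier G" "y \<in> carrier G"
  shows "inv x \<otimes> (x \<otimes> y) = y" "x \<otimes> (inv x \<otimes> y) = y"
  using assms by (simp_all flip: m_assoc)

lemmas group_normalize = m_assoc inv_mult_group inv_mult_cancel

lemma commute_inv:
  assumes "x \<in> carrier G" "y \<in> carrier G" "x \<otimes> y = y \<otimes> x"
  shows "inv x \<otimes> y = y \<otimes> inv x"
proof -
  have "inv x \<otimes> y = inv x \<otimes> (y \<otimes> x) \<otimes> inv x"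
    using assms(1,2) by (simp add: group_normalize)
  also have "\<dots> = y \<otimes> inv x"
    using assms(1,2) by (simp add: assms(3)[symmetric] group_normalize)
  finally show ?thesis .
qed

lemma commute_mult:
  assumes "a \<in> carrier G" "b \<in> carrier G" "z \<in> carrier G" "a \<otimes> z = z \<otimes> a" "b \<otimes> z = z \<otimes> b"
  shows "(a \<otimes> b) \<otimes> z = z \<otimes> (a \<otimes> b)"
proof -
  have "(a \<otimes> b) \<otimes> z = (a \<otimes> z) \<otimes> b" using assms(1-3) by (simp add: m_assoc assms(5))
  also have "\<dots> = (z \<otimes> a) \<otimes> b" by (simp only: assms(4))
  also have "\<dots> = z \<otimes> (a \<otimes> b)" using assms(1-3) by (simp add: m_assoc)
  finally show ?thesis .
qed

text \<open>Together with \<open>x\<close> and \<open>y\<close>, this makes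
  \<open>x \<otimes> y\<close> the third member of a pairwise noncommuting triple.\<close>

lemma not_commute_mult:
  assumes "x \<in> carrier G" "y \<in> carrier G" "x \<otimes> y \<noteq> y \<otimes> x"
  shows "x \<otimes> (x \<otimes> y) \<noteq> (x \<otimes> y) \<otimes> x" "y \<otimes> (x \<otimes> y) \<noteq> (x \<otimes> y) \<otimes> y"
  using assms by (metis l_cancel m_assoc m_closed, metis r_cancel m_assoc m_closed)

lemma T_group_3_1_commute:
  assumes "T_group 3 1 G" "x \<in> carrier G" "y \<in> carrier G"
  shows "x \<otimes> y = y \<otimes> x"
  using T_group_3D[OF assms(1), of "{x}" "{y}" "{x \<otimes> y}"] not_commute_mult[of x y] assms(2,3)
  by auto

text \<open>If \<open>x\<close> and \<open>y\<close> do not commute, the only pair among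
  \<open>x\<close>, \<open>y\<close>, \<open>xy\<close>, \<open>xy^-1\<close> that can commute is
  the last one. This forces \<open>y^2\<close> to commute with \<open>x\<close>, and in odd order
  \<open>y\<close> is a power of \<open>y^2\<close>.\<close>

lemma T_group_4_1_odd_commute:
  assumes T: "T_group 4 1 G" and fin: "finite (carrier G)" and odd: "odd (order G)"
    and x: "x \<in> carrier G" and y: "y \<in> carrier G"
  shows "x \<otimes> y = y \<otimes> x"
proof (rule ccontr)
  assume ne: "x \<otimes> y \<noteq> y \<otimes> x"
  have iy: "inv y \<in> carrier G" using y by simp
  have ne': "x \<otimes> inv y \<noteq> inv y \<otimes> x"
    using commute_inv[OF iy x] ne x y by auto
  have yc: "y \<otimes> (x \<otimes> inv y) \<noteq> (x \<otimes> inv y) \<otimes> y"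
  proof
    assume "y \<otimes> (x \<otimes> inv y) = (x \<otimes> inv y) \<otimes> y"
    then have "(y \<otimes> x) \<otimes> inv y = x" using x y by (simp add: m_assoc)
    then show False using ne x y by (simp add: inv_solve_right')
  qed
  have c: "x \<otimes> y \<otimes> (x \<otimes> inv y) = x \<otimes> inv y \<otimes> (x \<otimes> y)"
    using T_group_4_1D[OF T x y, of "x \<otimes> y" "x \<otimes> inv y"] ne yc x y
      not_commute_mult[OF x y ne] not_commute_mult[OF x iy ne'] by auto
  have "x \<otimes> (y \<otimes> (x \<otimes> inv y)) = x \<otimes> (inv y \<otimes> (x \<otimes> y))"
    using c x y by (simp add: m_assoc)
  then have "y \<otimes> (x \<otimes> inv y) = inv y \<otimes> (x \<otimes> y)" using x y by simp
  \<comment> \<open>Multiplying by \<open>y\<close> on both sides clears the inverses and leaves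
    \<open>y^2 x = x y^2\<close>.\<close>
  then have "y \<otimes> (y \<otimes> (x \<otimes> inv y)) \<otimes> y = y \<otimes> (inv y \<otimes> (x \<otimes> y)) \<otimes> y" by simp
  then have "y \<otimes> y \<otimes> x = x \<otimes> (y \<otimes> y)" using x y by (simp add: group_normalize)
  then have sq: "(y [^] (2::nat)) \<otimes> x = x \<otimes> (y [^] (2::nat))"
    using y by (simp add: numeral_2_eq_2)
  have pow: "(y [^] (2 * k)) \<otimes> x = x \<otimes> (y [^] (2 * k))" for k :: nat
  proof (induction k)
    case 0
    then show ?case using x by simp
  next
    case (Suc k)
    have "(y [^] (2 * Suc k)) = (y [^] (2 * k)) \<otimes> (y [^] (2::nat))"
      using y by (simp add: nat_pow_mult)
    then show ?case using commute_mult[OF _ _ x Suc sq] y by simp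
  qed
  obtain k where k: "order G = 2 * k + 1" using odd oddE by blast
  \<comment> \<open>The exponent is \<open>order G + 1\<close>, which is even.\<close>
  have "y [^] (2 * (k + 1)) = y"
  proof -
    have "y [^] (2 * (k + 1)) = y [^] order G \<otimes> y" using k y by simp
    then show ?thesis using pow_order_eq_1[OF y] y by simp
  qed
  with pow[of "k + 1"] ne show False by simp
qed

lemma T_group_3_2_centralizer:
  assumes T: "T_group 3 2 G" and x: "x \<in> carrier G" and y: "y \<in> carrier G"
    and ne: "x \<otimes> y \<noteq> y \<otimes> x"
    and c: "c \<in> carrier G" "x \<otimes> c = c \<otimes> x" "y \<otimes> c = c \<otimes> y"
  shows "c = \<one>"
proof (rule ccontr)
  assume c1: "c \<noteq> \<one>"
  txt \<open>\<open>x\<close>, \<open>y\<close>, \<open>xy\<close>, each multiplied by \<open>{1, c}\<close>, form a forbidden triple.\<close>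
  define D where "D z = (\<lambda>u. z \<otimes> u) ` {\<one>, c}" for z
  have D: "D z \<subseteq> carrier G" "finite (D z)" "card (D z) = 2" if "z \<in> carrier G" for z
    using that c c1 by (auto simp: D_def card_insert_if)
  \<comment> \<open>The factors from \<open>{\<one>, c}\<close> commute with \<open>z\<close> and
    \<open>w\<close>, so they can be collected on the right and cancelled.\<close>
  have cc: "z \<otimes> w = w \<otimes> z"
    if zw: "p \<in> D z" "q \<in> D w" "p \<otimes> q = q \<otimes> p" "z \<in> carrier G" "w \<in> carrier G"
      "z \<otimes> c = c \<otimes> z" "w \<otimes> c = c \<otimes> w" for z w p q
  proof -
    obtain u v where uv: "u \<in> {\<one>, c}" "v \<in> {\<one>, c}" "p = z \<otimes> u" "q = w \<otimes> v"
      using zw(1,2) unfolding D_def by blast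
    have uvc: "u \<in> carrier G" "v \<in> carrier G" "u \<otimes> v = v \<otimes> u" "u \<otimes> w = w \<otimes> u" "v \<otimes> z = z \<otimes> v"
      using uv zw c by auto
    have "(z \<otimes> w) \<otimes> (u \<otimes> v) = p \<otimes> q" using uv uvc zw(4,5) by (metis m_assoc m_closed)
    also have "\<dots> = q \<otimes> p" using zw by simp
    also have "\<dots> = (w \<otimes> z) \<otimes> (u \<otimes> v)" using uv uvc zw(4,5) by (metis m_assoc m_closed)
    finally show ?thesis using uvc zw(4,5) by (metis r_cancel m_closed)
  qed
  have xy: "x \<otimes> y \<in> carrier G" "(x \<otimes> y) \<otimes> c = c \<otimes> (x \<otimes> y)"
    using x y c by (simp, metis m_assoc)
  show False
    using T_group_3D[OF T D[OF x] D[OF y] D[OF xy(1)]] cc x y xy c ne not_commute_mult[OF x y ne]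
    by blast
qed

text \<open>In a nonabelian \<open>G\<close> some \<open>x\<close> fails to centralise
  \<open>A\<close>, and then it commutes with no nontrivial element of \<open>A\<close>. Hence
  distinct elements of the coset \<open>xA\<close> never commute with each other, nor with a
  nontrivial element of \<open>A\<close>; four elements of \<open>A\<close> are enough to build
  three pairs from this.\<close>

lemma T_group_3_2_commute:
  assumes T: "T_group 3 2 G" and A: "A \<lhd> G"
    and comm: "\<And>a b. a \<in> A \<Longrightarrow> b \<in> A \<Longrightarrow> a \<otimes> b = b \<otimes> a"
    and F: "F \<subseteq> A" "card F = 4"
    and uv: "u \<in> carrier G" "v \<in> carrier G"
  shows "u \<otimes> v = v \<otimes> u"
proof (rule ccontr)
  assume ne: "u \<otimes> v \<noteq> v \<otimes> u"
  interpret A: normal A G by fact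
  have finF: "finite F" using F(2) by (metis card.infinite zero_neq_numeral)
  have "3 \<le> card (F - {\<one>})" using F(2) finF by (simp add: card_Diff_singleton_if)
  then obtain S where S: "S \<subseteq> F - {\<one>}" "card S = 3"
    by (metis obtain_subset_with_card_n)
  then obtain a b c where abc: "S = {a, b, c}" "a \<noteq> b" "a \<noteq> c" "b \<noteq> c"
    by (auto simp: card_3_iff)
  have inA: "a \<in> A" "b \<in> A" "c \<in> A" and n1: "a \<noteq> \<one>" "b \<noteq> \<one>" "c \<noteq> \<one>"
    using S abc F by auto
  have carr: "\<And>p. p \<in> A \<Longrightarrow> p \<in> carrier G" using A.subset by blast
  \<comment> \<open>Were \<open>A\<close> central, the nontrivial \<open>a\<close> would commute
    with both \<open>u\<close> and \<open>v\<close>.\<close>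
  have "\<exists>x\<in>carrier G. \<exists>d\<in>A. x \<otimes> d \<noteq> d \<otimes> x"
    using T_group_3_2_centralizer[OF T uv ne carr[OF inA(1)]] inA n1 uv by metis
  then obtain x d where x: "x \<in> carrier G" and d: "d \<in> A" "x \<otimes> d \<noteq> d \<otimes> x" by blast
  \<comment> \<open>As \<open>A\<close> is abelian, \<open>p\<close> also commutes with
    \<open>d\<close>, so it centralises the noncommuting pair \<open>x\<close>,
    \<open>d\<close>.\<close>
  have C: "p = \<one>" if "p \<in> A" "x \<otimes> p = p \<otimes> x" for p
    using T_group_3_2_centralizer[OF T x carr[OF d(1)] d(2) carr[OF that(1)] that(2) comm[OF d(1) that(1)]] .
  have elt_coset: "p = \<one>" if p: "p \<in> A" "q \<in> A" "p \<otimes> (x \<otimes> q) = (x \<otimes> q) \<otimes> p" for p q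
  proof -
    have "(p \<otimes> x) \<otimes> q = (x \<otimes> p) \<otimes> q"
      using p x carr comm[OF p(1,2)] by (simp add: m_assoc)
    then have "p \<otimes> x = x \<otimes> p" using p x carr by simp
    then show ?thesis using C[OF p(1)] by simp
  qed
  have coset_coset: "p = q" if p: "p \<in> A" "q \<in> A" "(x \<otimes> p) \<otimes> (x \<otimes> q) = (x \<otimes> q) \<otimes> (x \<otimes> p)" for p q
  proof -
    \<comment> \<open>Writing \<open>p = rq\<close> and moving every \<open>x\<close> to the left
      turns \<open>r\<close> and \<open>q\<close> into their conjugates \<open>s\<close> and
      \<open>t\<close>; cancellation then leaves \<open>s = r\<close>, which says that
      \<open>r\<close> commutes with \<open>x\<close>.\<close>
    define r where "r = p \<otimes> inv q"
    define s where "s = inv x \<otimes> r \<otimes> x"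
    define t where "t = inv x \<otimes> q \<otimes> x"
    have pr: "p = r \<otimes> q" unfolding r_def using p carr by (simp add: m_assoc)
    have rA: "r \<in> A" unfolding r_def using p by auto
    have stA: "s \<in> A" "t \<in> A"
      unfolding s_def t_def using A.inv_op_closed1 rA p x by auto
    note cs = x carr[OF p(1)] carr[OF p(2)] carr[OF rA] carr[OF stA(1)] carr[OF stA(2)]
    have rx: "r \<otimes> x = x \<otimes> s" and qx: "q \<otimes> x = x \<otimes> t"
      unfolding s_def t_def using cs by (simp_all add: group_normalize)
    have "x \<otimes> (s \<otimes> (t \<otimes> q)) = (r \<otimes> x) \<otimes> (t \<otimes> q)" using rx cs by (simp add: m_assoc)
    also have "\<dots> = r \<otimes> (q \<otimes> x) \<otimes> q" using qx cs by (simp add: m_assoc)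
    also have "\<dots> = p \<otimes> (x \<otimes> q)" using pr cs by (simp add: m_assoc)
    also have "\<dots> = q \<otimes> (x \<otimes> p)" using p(3) cs by (simp add: m_assoc)
    also have "\<dots> = (q \<otimes> x) \<otimes> (r \<otimes> q)" unfolding pr[symmetric] using cs by (simp add: m_assoc)
    also have "\<dots> = x \<otimes> ((t \<otimes> r) \<otimes> q)" using qx cs by (simp add: m_assoc)
    also have "\<dots> = x \<otimes> (r \<otimes> (t \<otimes> q))" using comm[OF stA(2) rA] cs by (simp add: m_assoc)
    finally have "s = r" using cs by simp
    then have "x \<otimes> r = r \<otimes> x" using rx by simp
    then have "r = \<one>" using C rA by simp
    then show "p = q" using pr p carr by simp
  qed
  txt \<open>By \<open>elt_coset\<close> and \<open>coset_coset\<close>, the sets \<open>{a, b}\<close>, \<open>{x, xa}\<close>, \<open>{xb, xc}\<close> form a forbidden triple.\<close>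
  have "(\<exists>p\<in>{a, b}. \<exists>q\<in>{x \<otimes> \<one>, x \<otimes> a}. p \<otimes> q = q \<otimes> p) \<or>
    (\<exists>p\<in>{a, b}. \<exists>q\<in>{x \<otimes> b, x \<otimes> c}. p \<otimes> q = q \<otimes> p) \<or>
    (\<exists>p\<in>{x \<otimes> \<one>, x \<otimes> a}. \<exists>q\<in>{x \<otimes> b, x \<otimes> c}. p \<otimes> q = q \<otimes> p)"
    by (rule T_group_3D[OF T]) (use x inA carr abc n1 in \<open>auto simp: card_insert_if\<close>)
  then consider p q where "p \<in> {a, b}" "q \<in> {\<one>, a, b, c}" "p \<otimes> (x \<otimes> q) = (x \<otimes> q) \<otimes> p"
    | p q where "p \<in> {\<one>, a}" "q \<in> {b, c}" "(x \<otimes> p) \<otimes> (x \<otimes> q) = (x \<otimes> q) \<otimes> (x \<otimes> p)"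
    by blast
  then show False
  proof cases
    case (1 p q)
    then have "p \<in> A" "q \<in> A" using inA by auto
    from elt_coset[OF this 1(3)] show False using 1(1) n1 by blast
  next
    case (2 p q)
    then have "p \<in> A" "q \<in> A" using inA by auto
    from coset_coset[OF this 2(3)] show False using 2(1,2) n1 abc by blast
  qed
qed

lemma derived_centralizes_small_normal:
  assumes N: "N \<lhd> G" and fin: "finite N" and card: "card N \<le> 3"
    and x: "x \<in> derived G (carrier G)" and z: "z \<in> N"
  shows "x \<otimes> z = z \<otimes> x"
proof -
  interpret N: normal N G by fact
  have carr: "\<And>p. p \<in> N \<Longrightarrow> p \<in> carrier G" using N.subset by blast
  \<comment> \<open>The centraliser of \<open>N\<close> is a subgroup, so it suffices that it
    contains the commutators generating the derived subgroup.\<close>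
  define C where "C = {g \<in> carrier G. \<forall>n\<in>N. g \<otimes> n = n \<otimes> g}"
  have C: "subgroup C G"
  proof (rule subgroupI)
    show "C \<subseteq> carrier G" by (auto simp: C_def)
    show "C \<noteq> {}" using carr by (auto simp: C_def intro!: exI[of _ \<one>])
    show "inv a \<in> C" if "a \<in> C" for a
      using that carr commute_inv unfolding C_def by auto
    show "a \<otimes> b \<in> C" if "a \<in> C" "b \<in> C" for a b
      using that carr commute_mult unfolding C_def by auto
  qed
  have conj: "g \<otimes> n \<otimes> inv g \<in> N - {\<one>}" if "g \<in> carrier G" "n \<in> N - {\<one>}" for g n
    using that carr N.inv_op_closed2[of g n] by (auto simp: inv_solve_right')
  have inj: "n = m" if "g \<otimes> n \<otimes> inv g = g \<otimes> m \<otimes> inv g" "g \<in> carrier G" "n \<in> N" "m \<in> N" for g n m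
    using that carr by simp
  have le2: "card (N - {\<one>}) \<le> 2" using card fin N.one_closed by (simp add: card_Diff_singleton)
  txt \<open>Conjugation permutes the at most two nontrivial elements of \<open>N\<close>, and permutations of at most
    two points commute.\<close>
  have swap: "g \<otimes> (h \<otimes> n \<otimes> inv h) \<otimes> inv g = h \<otimes> (g \<otimes> n \<otimes> inv g) \<otimes> inv h"
    if g: "g \<in> carrier G" and h: "h \<in> carrier G" and n: "n \<in> N - {\<one>}" for g h n
  proof -
    \<comment> \<open>\<open>m\<close> coincides with \<open>n\<close> when \<open>n\<close> is the
      only nontrivial element.\<close>
    obtain m where m: "N - {\<one>} = {n, m}"
    proof (cases "N - {\<one>} = {n}")
      case False
      then obtain m where m: "m \<in> N - {\<one>}" "m \<noteq> n" using n by blast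
      have "{n, m} = N - {\<one>}"
        by (rule card_seteq) (use fin n m le2 in auto)
      then show ?thesis using that by blast
    qed (use that in blast)
    define cg where "cg = (\<lambda>p. g \<otimes> p \<otimes> inv g)"
    define ch where "ch = (\<lambda>p. h \<otimes> p \<otimes> inv h)"
    have nm: "n \<in> N" "m \<in> N" using m by blast+
    have "cg n \<in> {n, m}" "cg m \<in> {n, m}" "ch n \<in> {n, m}" "ch m \<in> {n, m}"
      using conj[OF g] conj[OF h] m unfolding cg_def ch_def by auto
    moreover have "cg n = cg m \<Longrightarrow> n = m" "ch n = ch m \<Longrightarrow> n = m"
      using inj[OF _ g nm] inj[OF _ h nm] unfolding cg_def ch_def by auto
    ultimately have "cg (ch n) = ch (cg n)" by auto
    then show ?thesis by (simp add: cg_def ch_def)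
  qed
  have "derived_set G (carrier G) \<subseteq> C"
  proof clarify
    fix g h assume g: "g \<in> carrier G" and h: "h \<in> carrier G"
    define k where "k = g \<otimes> h \<otimes> inv g \<otimes> inv h"
    have k: "k \<in> carrier G" unfolding k_def using g h by simp
    have "k \<otimes> p = p \<otimes> k" if p: "p \<in> N" for p
    proof (cases "p = \<one>")
      case True
      then show ?thesis using k by simp
    next
      case False
      \<comment> \<open>With \<open>p\<close> written as the conjugate of \<open>n\<close> by
        \<open>hg\<close>, conjugation by the commutator \<open>k\<close> yields the conjugate of
        \<open>n\<close> by \<open>gh\<close>, which is \<open>p\<close> again by
        \<open>swap\<close>.\<close>
      define n where "n = inv (h \<otimes> g) \<otimes> p \<otimes> (h \<otimes> g)"
      have nN: "n \<in> N" unfolding n_def using p g h by (intro N.inv_op_closed1) auto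
      have "p = (h \<otimes> g) \<otimes> n \<otimes> inv (h \<otimes> g)"
        unfolding n_def using carr[OF p] g h by (simp add: group_normalize)
      then have "n \<noteq> \<one>" using False g h by auto
      then have "g \<otimes> (h \<otimes> n \<otimes> inv h) \<otimes> inv g = h \<otimes> (g \<otimes> n \<otimes> inv g) \<otimes> inv h"
        using swap[OF g h] nN by blast
      then have "k \<otimes> p \<otimes> inv k = p"
        unfolding n_def k_def using carr[OF p] g h by (simp add: group_normalize)
      then show ?thesis using carr[OF p] k by (simp add: inv_solve_right')
    qed
    then show "g \<otimes> h \<otimes> inv g \<otimes> inv h \<in> C" using k(1) unfolding C_def k_def by blast
  qed
  then have "derived G (carrier G) \<subseteq> C"
    unfolding derived_def by (rule generate_subgroup_incl[OF _ C])
  then show ?thesis using x z by (auto simp: C_def)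
qed

end

section \<open>Cosets and the derived series of a quotient\<close>

lemma (in normal) r_coset_mult_mem:
  assumes "z \<in> H" "g \<in> carrier G"
  shows "H #> (z \<otimes> g) = H #> g"
  using assms by (metis coset_mult_assoc mem_carrier rcos_const is_group subset)

lemma (in normal) r_coset_eqD:
  assumes "H #> a = H #> b" "a \<in> carrier G"
  obtains z where "z \<in> H" "a = z \<otimes> b"
  using rcos_self[OF assms(2) subgroup_axioms] assms(1) that by (auto simp: r_coset_def)

lemma (in normal) r_coset_group_hom: "group_hom G (G Mod H) ((#>) H)"
  by (rule group_hom.intro)
    (use factorgroup_is_group r_coset_hom_Mod in \<open>auto simp: group_hom_axioms_def is_group\<close>)

lemma (in normal) exp_of_derived_Mod:
  "(derived (G Mod H) ^^ i) (carrier (G Mod H)) = (#>) H ` (derived G ^^ i) (carrier G)"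
proof -
  have "(#>) H ` carrier G = carrier (G Mod H)"
    by (auto simp: FactGroup_def RCOSETS_def)
  then show ?thesis
    using group_hom.exp_of_derived_img[OF r_coset_group_hom, of "carrier G" i] by simp
qed

section \<open>Derived subgroups and the case T(3,4)\<close>

context group
begin

lemma derived_subset_of_commute_Mod:
  assumes "N \<lhd> G"
    and "\<And>a b. a \<in> carrier (G Mod N) \<Longrightarrow> b \<in> carrier (G Mod N) \<Longrightarrow>
      a \<otimes>\<^bsub>G Mod N\<^esub> b = b \<otimes>\<^bsub>G Mod N\<^esub> a"
  shows "derived G (carrier G) \<subseteq> N"
  using derived_minimal[OF assms(1)] group.group_comm_groupI[OF normal.factorgroup_is_group[OF assms(1)]]
    assms(2) by blast

lemma exp_of_derived_normal: "(derived G ^^ i) (carrier G) \<lhd> G"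
  by (induction i) (simp_all add: normal_self derived_is_normal)

lemma derived_trivial_of_commute:
  assumes K: "K \<subseteq> carrier G" and comm: "\<And>x y. x \<in> K \<Longrightarrow> y \<in> K \<Longrightarrow> x \<otimes> y = y \<otimes> x"
  shows "derived G K = {\<one>}"
proof -
  have "derived_set G K \<subseteq> {\<one>}"
  proof clarify
    fix x y assume xy: "x \<in> K" "y \<in> K"
    then have "x \<otimes> y \<otimes> inv x \<otimes> inv y = y \<otimes> x \<otimes> inv x \<otimes> inv y" using comm by simp
    also have "\<dots> = \<one>" using xy K by (simp add: m_assoc subset_iff)
    finally show "x \<otimes> y \<otimes> inv x \<otimes> inv y = \<one>" .
  qed
  then have "derived G K \<subseteq> {\<one>}"
    unfolding derived_def by (rule generate_subgroup_incl[OF _ triv_subgroup])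
  then show ?thesis
    using subgroup.one_closed[OF derived_is_subgroup[OF K]] by blast
qed

text \<open>The second alternative is that of a perfect derived subgroup. Applied to the quotient by
  the third derived subgroup of a solvable group, each alternative contradicts strict descent of the
  derived series.\<close>

lemma T_group_3_4_derived:
  assumes T: "T_group 3 4 G"
  defines "K \<equiv> derived G (carrier G)"
  shows "derived G K = {\<one>} \<or> derived G K = K"
proof (rule ccontr)
  assume "\<not> ?thesis"
  then have n1: "derived G K \<noteq> {\<one>}" and nK: "derived G K \<noteq> K" by auto
  have K: "K \<lhd> G" unfolding K_def by (rule derived_self_is_normal)
  have Ksub: "subgroup K G" using K by (rule normal_imp_subgroup)
  define N where "N = derived G K"
  have N: "N \<lhd> G" unfolding N_def by (rule derived_is_normal[OF K])
  interpret N: normal N G by fact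
  interpret Q: group "G Mod N" by (rule N.factorgroup_is_group)
  have Kc: "\<And>p. p \<in> K \<Longrightarrow> p \<in> carrier G" using subgroup.subset[OF Ksub] by blast
  have NK: "N \<subseteq> K" unfolding N_def by (rule derived_incl[OF order_refl Ksub])
  \<comment> \<open>An abelian quotient would give \<open>K \<subseteq> N\<close>, hence
    \<open>N = K\<close>. Both cases below end in this contradiction.\<close>
  have not_comm: False if "\<And>a b. a \<in> carrier (G Mod N) \<Longrightarrow> b \<in> carrier (G Mod N) \<Longrightarrow>
      a \<otimes>\<^bsub>G Mod N\<^esub> b = b \<otimes>\<^bsub>G Mod N\<^esub> a"
    using derived_subset_of_commute_Mod[OF N that] NK nK unfolding N_def K_def by blast
  show False
  proof (cases "finite N \<and> card N \<le> 3")
    case False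
    have "\<exists>F. F \<subseteq> N \<and> finite F \<and> card F = 4"
    proof (cases "finite N")
      case True
      then have "4 \<le> card N" using False by simp
      then show ?thesis using obtain_subset_with_card_n by metis
    next
      case inf: False
      then show ?thesis using infinite_arbitrarily_large by metis
    qed
    then obtain F where F: "F \<subseteq> N" "finite F" "card F = 4" by blast
    then have "T_group 3 1 (G Mod N)" using T_group_Mod[OF T N F(1,2), of 1] by simp
    then show False using not_comm Q.T_group_3_1_commute by blast
  next
    case True
    have central: "k \<otimes> z = z \<otimes> k" if "k \<in> K" "z \<in> N" for k z
      using derived_centralizes_small_normal[OF N] True that unfolding K_def by blast
    obtain z where z: "z \<in> N" "z \<noteq> \<one>" using n1 N.one_closed unfolding N_def by blast
    \<comment> \<open>Whether \<open>N\<close> has two or three elements, the two-element set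
      \<open>{\<one>, z}\<close> suffices, because \<open>4 \<le> 2 * 2\<close>.\<close>
    have "T_group 3 2 (G Mod N)"
      using T_group_Mod[OF T N, of "{\<one>, z}" 2] z N.one_closed by simp
    obtain x y where xy: "x \<in> K" "y \<in> K" "x \<otimes> y \<noteq> y \<otimes> x"
      using derived_trivial_of_commute[OF subgroup.subset[OF Ksub]] n1 by blast
    \<comment> \<open>This is \<open>K/N\<close>, the derived subgroup of the quotient; it is
      abelian because \<open>N\<close> is the derived subgroup of \<open>K\<close>.\<close>
    define A where "A = (#>) N ` K"
    have "A \<lhd> G Mod N"
      using Q.derived_self_is_normal N.exp_of_derived_Mod[of 1] unfolding A_def K_def by simp
    have Acomm: "a \<otimes>\<^bsub>G Mod N\<^esub> b = b \<otimes>\<^bsub>G Mod N\<^esub> a" if ab: "a \<in> A" "b \<in> A" for a b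
    proof -
      obtain u v where uv: "u \<in> K" "v \<in> K" "a = N #> u" "b = N #> v"
        using ab unfolding A_def by blast
      have "u \<otimes> v \<otimes> inv u \<otimes> inv v \<in> N"
        unfolding N_def derived_def by (rule generate.incl) (use uv in blast)
      from N.r_coset_mult_mem[OF this, of "v \<otimes> u"]
      have "N #> (u \<otimes> v) = N #> (v \<otimes> u)"
        using uv Kc by (simp add: group_normalize)
      then show ?thesis using uv Kc by (simp add: FactGroup_def N.rcos_sum)
    qed
    \<comment> \<open>Elements of one coset differ by a factor in \<open>N\<close>, which commutes
      with \<open>w\<close>. So commuting with \<open>w\<close> is a property of the coset and can
      tell cosets apart.\<close>
    have sep: "N #> u \<noteq> N #> v" if uvw: "u \<in> K" "v \<in> K" "w \<in> K" "u \<otimes> w = w \<otimes> u" "v \<otimes> w \<noteq> w \<otimes> v" for u v w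
    proof
      assume "N #> u = N #> v"
      then obtain c where c: "c \<in> N" "v = c \<otimes> u" using N.r_coset_eqD Kc[OF uvw(2)] by metis
      then have "v \<otimes> w = w \<otimes> v"
        using commute_mult[of c u w] central[OF uvw(3) c(1)] uvw Kc NK by auto
      with uvw(5) show False by simp
    qed
    have xyK: "x \<otimes> y \<in> K" "\<one> \<in> K"
      using subgroup.m_closed[OF Ksub] subgroup.one_closed[OF Ksub] xy by auto
    note nc = not_commute_mult[OF Kc[OF xy(1)] Kc[OF xy(2)] xy(3)]
    define F where "F = {N #> \<one>, N #> x, N #> y, N #> (x \<otimes> y)}"
    have "N #> \<one> \<noteq> N #> x" "N #> \<one> \<noteq> N #> y" "N #> \<one> \<noteq> N #> (x \<otimes> y)"
      "N #> x \<noteq> N #> y" "N #> x \<noteq> N #> (x \<otimes> y)" "N #> y \<noteq> N #> (x \<otimes> y)"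
      using sep[of \<one> x y] sep[of \<one> y x] sep[of \<one> "x \<otimes> y" x] sep[of x y x]
        sep[of x "x \<otimes> y" x] sep[of y "x \<otimes> y" y] xy xyK nc Kc by force+
    then have "card F = 4" unfolding F_def by (simp add: card_insert_if)
    moreover have "F \<subseteq> A" unfolding F_def A_def using xy xyK by blast
    ultimately show False
      using Q.T_group_3_2_commute[OF \<open>T_group 3 2 (G Mod N)\<close> \<open>A \<lhd> G Mod N\<close> Acomm] not_comm
      by blast
  qed
qed

section \<open>Growth of the derived series from its trivial end\<close>

lemma exp_of_derived_Suc_psubset:
  assumes "solvable G" "i < derived_length G"
  shows "(derived G ^^ Suc i) (carrier G) \<subset> (derived G ^^ i) (carrier G)"
proof
  let ?D = "\<lambda>i. (derived G ^^ i) (carrier G)"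
  show "?D (Suc i) \<subseteq> ?D i"
    using derived_incl[OF order_refl exp_of_derived_is_subgroup[OF subgroup_self]] by simp
  show "?D (Suc i) \<noteq> ?D i"
  proof
    assume eq: "?D (Suc i) = ?D i"
    \<comment> \<open>A repeated term makes the series constant from \<open>i\<close> on, so the
      term at \<open>i\<close> is already trivial, against the minimality of
      \<open>derived_length\<close>.\<close>
    have "?D (i + k) = ?D i" for k
    proof (induction k)
      case (Suc k)
      then have "?D (i + Suc k) = derived G (?D i)" by simp
      then show ?case using eq by simp
    qed simp
    from this[of "derived_length G - i"] have "?D i = {\<one>}"
      using assms derived_length_trivial by simp
    then show False
      using not_less_Least[of i "\<lambda>k. ?D k = {\<one>}"] assms(2) by (simp add: derived_length_def)
  qed
qed

text \<open>For \<open>b\<close> in \<open>B\<close> outside \<open>A\<close>, the translate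
  \<open>bF\<close> avoids \<open>A\<close> and is therefore disjoint from \<open>F\<close>. Finite
  subsets express index at least 2 even for infinite groups.\<close>

lemma double_card_subset:
  assumes A: "subgroup A G" and B: "subgroup B G" and AB: "A \<subset> B"
    and F: "F \<subseteq> A" "finite F"
  shows "\<exists>E\<subseteq>B. finite E \<and> card E = 2 * card F"
proof -
  obtain b where b: "b \<in> B" "b \<notin> A" using AB by blast
  have carr: "b \<in> carrier G" "\<And>f. f \<in> F \<Longrightarrow> f \<in> carrier G"
    using b F A B by (auto dest: subgroup.mem_carrier)
  have "inj_on ((\<otimes>) b) F" using carr by (auto intro!: inj_onI)
  then have "card ((\<otimes>) b ` F) = card F" by (rule card_image)
  moreover have "F \<inter> (\<otimes>) b ` F = {}"
  proof -
    have "b \<otimes> f \<notin> A" if "f \<in> F" for f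
    proof
      assume "b \<otimes> f \<in> A"
      then have "(b \<otimes> f) \<otimes> inv f \<in> A"
        using that F(1) A by (meson subgroup.m_closed subgroup.m_inv_closed subset_iff)
      then show False using b(2) carr that by (simp add: m_assoc)
    qed
    then show ?thesis using F(1) by blast
  qed
  ultimately have "card (F \<union> (\<otimes>) b ` F) = 2 * card F" using F(2) by (simp add: card_Un_disjoint)
  moreover have "F \<union> (\<otimes>) b ` F \<subseteq> B" using F AB b B by (auto intro: subgroup.m_closed)
  ultimately show ?thesis using F(2) by blast
qed

text \<open>Counting steps upward from the trivial term, each strict inclusion doubles the available
  finite set.\<close>

lemma exp_of_derived_large:
  assumes sol: "solvable G" and "i \<le> derived_length G"
  shows "\<exists>F \<subseteq> (derived G ^^ (derived_length G - i)) (carrier G). finite F \<and> card F = 2 ^ i"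
  using assms(2)
proof (induction i)
  case 0
  show ?case using derived_length_trivial[OF sol] by (intro exI[of _ "{\<one>}"]) simp
next
  case (Suc i)
  let ?j = "derived_length G - Suc i"
  have j: "derived_length G - i = Suc ?j" "?j < derived_length G" using Suc.prems by auto
  obtain F where F: "F \<subseteq> (derived G ^^ Suc ?j) (carrier G)" "finite F" "card F = 2 ^ i"
    using Suc j by auto
  have sub: "subgroup ((derived G ^^ k) (carrier G)) G" for k
    by (rule exp_of_derived_is_subgroup[OF subgroup_self])
  from double_card_subset[OF sub sub exp_of_derived_Suc_psubset[OF sol j(2)] F(1,2)] F(3)
  show ?case by simp
qed

text \<open>The index divides the odd number \<open>card B\<close> and is not 1, so it is at least
  3.\<close>

lemma card_psubgroup_odd:
  assumes A: "subgroup A G" and B: "subgroup B G" and AB: "A \<subset> B"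
    and fin: "finite (carrier G)" and odd: "odd (order G)"
  shows "3 * card A \<le> card B"
proof -
  define k where "k = card (rcosets\<^bsub>G\<lparr>carrier := B\<rparr>\<^esub> A)"
  have k: "k * card A = card B"
    using group.lagrange[OF subgroup_imp_group[OF B] subgroup_incl[OF A B]] AB
    by (simp add: k_def order_def)
  have finB: "finite B" using fin subgroup.subset[OF B] finite_subset by blast
  have "odd (card B)" using lagrange[OF B] odd by (metis dvd_mult)
  with k have "odd k" by (metis dvd_mult2)
  moreover have "k \<noteq> 1" using k psubset_card_mono[OF finB AB] by auto
  ultimately have "3 \<le> k" by presburger
  then show ?thesis using k by (metis mult_le_mono1)
qed

lemma card_exp_of_derived_odd:
  assumes sol: "solvable G" and fin: "finite (carrier G)" and odd: "odd (order G)"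
    and "i \<le> derived_length G"
  shows "3 ^ i \<le> card ((derived G ^^ (derived_length G - i)) (carrier G))"
  using assms(4)
proof (induction i)
  case 0
  show ?case using derived_length_trivial[OF sol] by simp
next
  case (Suc i)
  let ?j = "derived_length G - Suc i"
  have j: "derived_length G - i = Suc ?j" "?j < derived_length G" using Suc.prems by auto
  have sub: "subgroup ((derived G ^^ k) (carrier G)) G" for k
    by (rule exp_of_derived_is_subgroup[OF subgroup_self])
  have "3 ^ Suc i \<le> 3 * card ((derived G ^^ Suc ?j) (carrier G))"
    using Suc j by simp
  also have "\<dots> \<le> card ((derived G ^^ ?j) (carrier G))"
    by (rule card_psubgroup_odd[OF sub sub exp_of_derived_Suc_psubset[OF sol j(2)] fin odd])
  finally show ?case .
qed

section \<open>The two bounds on the derived length\<close>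

lemma T_group_3_derived_length:
  assumes sol: "solvable G" and n: "n \<ge> 1" and T: "T_group 3 n G"
  shows "2 ^ (derived_length G - 1) \<le> n"
proof (rule ccontr)
  let ?D = "\<lambda>i. (derived G ^^ i) (carrier G)"
  let ?d = "derived_length G"
  assume "\<not> ?thesis"
  then have lt: "n < 2 ^ (?d - 1)" by simp
  have strict: "?D (Suc i) \<subset> ?D i" if "i < ?d" for i
    by (rule exp_of_derived_Suc_psubset[OF sol that])
  \<comment> \<open>For derived length at most 1 the truncated exponent is 0, and
    \<open>n < 1\<close> is impossible.\<close>
  have "?d \<ge> 2" using lt n by (cases "?d \<le> 1") auto
  show False
  proof (cases "?d = 2")
    case True
    \<comment> \<open>The quotient argument needs the second and third derived subgroups to differ,
      which fails at derived length 2; there \<open>n = 1\<close> makes \<open>G\<close>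
      abelian.\<close>
    then have "n = 1" using lt n by simp
    then have "T_group 3 1 G" using T by simp
    then have "derived G (carrier G) = {\<one>}"
      using derived_trivial_of_commute[of "carrier G"] T_group_3_1_commute by blast
    moreover have "\<one> \<in> ?D 2"
      using subgroup.one_closed[OF exp_of_derived_is_subgroup[OF subgroup_self]] by blast
    ultimately show False using strict[of 1] True by (auto simp: numeral_2_eq_2)
  next
    case False
    then have d: "?d \<ge> 3" using \<open>?d \<ge> 2\<close> by simp
    define N where "N = ?D 3"
    have N: "N \<lhd> G" unfolding N_def by (rule exp_of_derived_normal)
    interpret N: normal N G by fact
    interpret Q: group "G Mod N" by (rule N.factorgroup_is_group)
    obtain F where F: "F \<subseteq> N" "finite F" "card F = 2 ^ (?d - 3)"
      using exp_of_derived_large[OF sol, of "?d - 3"] d unfolding N_def by auto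
    \<comment> \<open>Thus \<open>n < 2^(d-1) = 4 * card F\<close>, which is what the T(3,4)
      property of the quotient requires.\<close>
    have "?d - 1 = (?d - 3) + 2" using d by simp
    then have "n \<le> card F * 4" using lt F(3) by (simp add: power_add)
    then have "T_group 3 4 (G Mod N)" by (rule T_group_Mod[OF T N F(1,2)])
    from Q.T_group_3_4_derived[OF this]
    have "(#>) N ` ?D 2 = {\<one>\<^bsub>G Mod N\<^esub>} \<or> (#>) N ` ?D 2 = (#>) N ` ?D 1"
      using N.exp_of_derived_Mod[of 1] N.exp_of_derived_Mod[of 2] by (simp add: numeral_2_eq_2)
    \<comment> \<open>A trivial second derived subgroup of the quotient gives
      \<open>?D 2 \<subseteq> ?D 3\<close>; a perfect first one gives
      \<open>?D 1 \<subseteq> ?D 2\<close>, since \<open>N\<close> lies in \<open>?D 2\<close>. Both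
      contradict \<open>strict\<close>.\<close>
    then show False
    proof
      assume *: "(#>) N ` ?D 2 = {\<one>\<^bsub>G Mod N\<^esub>}"
      have "?D 2 \<subseteq> N"
      proof
        fix a assume a: "a \<in> ?D 2"
        then have "a \<in> carrier G" using exp_of_derived_in_carrier[of "carrier G" 2] by blast
        moreover have "N #> a = N" using * a by (auto simp: FactGroup_def)
        ultimately show "a \<in> N" using rcos_self[OF _ N.subgroup_axioms] by blast
      qed
      then show False using strict[of 2] d unfolding N_def by (auto simp: numeral_3_eq_3 numeral_2_eq_2)
    next
      assume *: "(#>) N ` ?D 2 = (#>) N ` ?D 1"
      have N2: "N \<subseteq> ?D 2" using strict[of 2] d unfolding N_def by (auto simp: numeral_3_eq_3 numeral_2_eq_2)
      have "?D 1 \<subseteq> ?D 2"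
      proof
        fix a assume a: "a \<in> ?D 1"
        then obtain b where b: "b \<in> ?D 2" "N #> a = N #> b" using * by blast
        have "a \<in> carrier G" using a exp_of_derived_in_carrier[of "carrier G" 1] by blast
        then obtain z where "z \<in> N" "a = z \<otimes> b" using N.r_coset_eqD[OF b(2)] by blast
        then show "a \<in> ?D 2"
          using b(1) N2 subgroup.m_closed[OF exp_of_derived_is_subgroup[OF subgroup_self]] by blast
      qed
      then show False using strict[of 1] d by (auto simp: numeral_2_eq_2)
    qed
  qed
qed

lemma T_group_4_odd_derived_length:
  assumes sol: "solvable G" and n: "n \<ge> 1" and T: "T_group 4 n G"
    and fin: "finite (carrier G)" and odd: "odd (order G)"
  shows "2 ^ (derived_length G - 1) \<le> n"
proof (rule ccontr)
  let ?d = "derived_length G"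
  assume "\<not> ?thesis"
  then have lt: "n < 2 ^ (?d - 1)" by simp
  have d: "?d \<ge> 2" using lt n by (cases "?d \<le> 1") auto
  define N where "N = (derived G ^^ 2) (carrier G)"
  have N: "N \<lhd> G" unfolding N_def by (rule exp_of_derived_normal)
  interpret N: normal N G by fact
  interpret Q: group "G Mod N" by (rule N.factorgroup_is_group)
  \<comment> \<open>With \<open>k = d - 2\<close> this gives
    \<open>n \<le> 2^(d-1) - 1 \<le> 3^(d-2) \<le> card N\<close>. Strictness of
    \<open>n < 2^(d-1)\<close> supplies the unit that is needed at \<open>d = 3\<close>.\<close>
  have pow: "2 ^ Suc k - 1 \<le> (3::nat) ^ k" for k
  proof (induction k)
    case (Suc k)
    moreover have "1 \<le> (3::nat) ^ k" by simp
    ultimately show ?case unfolding power_Suc by linarith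
  qed simp
  have "n \<le> 2 ^ Suc (?d - 2) - 1" using lt d by (simp add: Suc_diff_le[symmetric] numeral_2_eq_2)
  also have "\<dots> \<le> card N"
    using card_exp_of_derived_odd[OF sol fin odd, of "?d - 2"] pow[of "?d - 2"] d
    unfolding N_def by simp
  finally have "T_group 4 1 (G Mod N)"
    using T_group_Mod[OF T N order_refl] fin N.subset finite_subset by fastforce
  moreover have "order (G Mod N) * card N = order G"
    using lagrange[OF N.subgroup_axioms] by (simp add: FactGroup_def order_def)
  then have "finite (carrier (G Mod N))" "odd (order (G Mod N))"
    using odd by (metis card.infinite dvd_0_right mult_zero_left order_def, metis dvd_mult2)
  ultimately have "derived G (carrier G) \<subseteq> N"
    by (intro derived_subset_of_commute_Mod[OF N] Q.T_group_4_1_odd_commute)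
  then show False
    using exp_of_derived_Suc_psubset[OF sol, of 1] d unfolding N_def by (auto simp: numeral_2_eq_2)
qed

end

theorem theorem3p3:
  fixes G :: "('a, 'b) monoid_scheme" and n :: nat
  assumes "n \<ge> 1"
    and "group G"
    and "solvable G"
    and "T_group 3 n G \<or> (T_group 4 n G \<and> finite (carrier G) \<and> odd (order G))"
  shows "real (derived_length G) \<le> log 2 (2 * real n)"
proof -
  have "2 ^ (derived_length G - 1) \<le> n"
    using group.T_group_3_derived_length[OF assms(2,3,1)]
      group.T_group_4_odd_derived_length[OF assms(2,3,1)] assms(4) by blast
  \<comment> \<open>At derived length 0 the subtraction truncates, and \<open>1 \<le> 2 * n\<close>
    comes from \<open>n \<ge> 1\<close>.\<close>
  then have "2 ^ derived_length G \<le> 2 * n"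
    using assms(1) by (cases "derived_length G") auto
  then have "2 ^ derived_length G \<le> 2 * real n"
    by (metis of_nat_le_iff of_nat_mult of_nat_numeral of_nat_power)
  then show ?thesis by (rule le_log_of_power) simp
qed

end
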